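(* Let $G$ be a finite multigraph and let $t$ be a positive integer. If there is a partition $P_0$ of $V(G)$ satisfying $|E(G)|-|E(P_0,G)|<t(|P_0|-1)$, then $r(G,t)=|E(G)|$. Otherwise, $$r(G,t)=\max_{P\colon |P|\geq 3}\{|E(P,G)|+t(|P|-2)\},$$ where the maximum is taken over all partitions $P$ of $V(G)$ with $|P|\geq 3$.
   Context: A partition $P$ of $V(G)$ is a partition into nonempty parts; $|P|$ denotes its number of parts. ${\rm cr}(P,G)$ is the set of crossing edges of $G$ (whose two end vertices lie in different parts of $P$), and $E(P,G)$ is the set of non-crossing edges (both end vertices in the same part). An edge-colored graph is rainbow if every edge receives a different color. The anti-Ramsey number $r(G,t)$ is the maximum number of colors in an edge-coloring of $G$ that contains no $t$ edge-disjoint rainbow spanning trees. *)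

theory Defs
  imports Complex_Main "HOL-Library.Disjoint_Sets"
begin

text \<open>
  Undirected multigraphs: edges are abstract objects, so parallel edges are distinct elements
  of \<^term>\<open>edges G\<close> with equal \<open>ends\<close>; a loop has a singleton as its set of end vertices.
\<close>

record ('v, 'e) multigraph =
  verts :: "'v set"
  edges :: "'e set"
  ends  :: "'e \<Rightarrow> 'v set"

definition finite_multigraph :: "('v, 'e) multigraph \<Rightarrow> bool" where
  "finite_multigraph G \<longleftrightarrow>
     finite (verts G) \<and> verts G \<noteq> {} \<and> finite (edges G) \<and>
     (\<forall>e\<in>edges G. ends G e \<subseteq> verts G \<and> card (ends G e) \<in> {1, 2})"

definition noncrossing :: "'v set set \<Rightarrow> ('v, 'e) multigraph \<Rightarrow> 'e set" where
  "noncrossing P G = {e \<in> edges G. \<exists>X\<in>P. ends G e \<subseteq> X}"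

definition adj_rel :: "('v, 'e) multigraph \<Rightarrow> 'e set \<Rightarrow> ('v \<times> 'v) set" where
  "adj_rel G T = {(u, v). \<exists>e\<in>T. ends G e = {u, v}}"

definition spanning_connected :: "('v, 'e) multigraph \<Rightarrow> 'e set \<Rightarrow> bool" where
  "spanning_connected G T \<longleftrightarrow> (\<forall>u\<in>verts G. \<forall>v\<in>verts G. (u, v) \<in> (adj_rel G T)\<^sup>*)"

text \<open>
  A cycle \<open>v\<^sub>0 e\<^sub>0 v\<^sub>1 e\<^sub>1 \<dots> v\<^sub>k\<^sub>-\<^sub>1 e\<^sub>k\<^sub>-\<^sub>1 v\<^sub>0\<close> with \<open>k \<ge> 1\<close>: length 1 is a loop,
  length 2 a pair of parallel edges.
\<close>

definition is_cycle :: "('v, 'e) multigraph \<Rightarrow> 'v list \<Rightarrow> 'e list \<Rightarrow> bool" where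
  "is_cycle G vs es \<longleftrightarrow>
     es \<noteq> [] \<and> length vs = length es \<and> distinct vs \<and> distinct es \<and>
     (\<forall>i<length es. ends G (es ! i) = {vs ! i, vs ! (Suc i mod length es)})"

definition acyclic_edges :: "('v, 'e) multigraph \<Rightarrow> 'e set \<Rightarrow> bool" where
  "acyclic_edges G T \<longleftrightarrow> \<not> (\<exists>vs es. set es \<subseteq> T \<and> is_cycle G vs es)"

text \<open>A spanning tree is identified with its edge set.\<close>

definition spanning_tree :: "('v, 'e) multigraph \<Rightarrow> 'e set \<Rightarrow> bool" where
  "spanning_tree G T \<longleftrightarrow>
     T \<subseteq> edges G \<and> spanning_connected G T \<and> acyclic_edges G T"

definition rainbow :: "('e \<Rightarrow> 'c) \<Rightarrow> 'e set \<Rightarrow> bool" where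
  "rainbow c T \<longleftrightarrow> inj_on c T"

definition has_disjoint_rainbow_spanning_trees ::
  "('v, 'e) multigraph \<Rightarrow> ('e \<Rightarrow> 'c) \<Rightarrow> nat \<Rightarrow> bool" where
  "has_disjoint_rainbow_spanning_trees G c t \<longleftrightarrow>
     (\<exists>T :: nat \<Rightarrow> 'e set.
        (\<forall>i<t. spanning_tree G (T i) \<and> rainbow c (T i)) \<and>
        disjoint_family_on T {..<t})"

text \<open>
  Colors are natural numbers, which is no restriction since the edge set is finite.  The set below
  is bounded by the number of edges; it is empty only if every coloring contains \<open>t\<close> such trees,
  and the maximum is then unspecified.
\<close>

definition anti_ramsey :: "('v, 'e) multigraph \<Rightarrow> nat \<Rightarrow> nat" where
  "anti_ramsey G t =
     Max {card (c ` edges G) | c :: 'e \<Rightarrow> nat. \<not> has_disjoint_rainbow_spanning_trees G c t}"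

end

theory Submission
  imports Defs
begin

text \<open>
  Edge sets carry the cycle matroid, with closure \<open>cl\<close>.  If every partition \<open>P\<close> has at least
  \<open>t (|P| - 1)\<close> crossing edges, then \<open>t\<close> disjoint spanning trees exist (Nash-Williams and Tutte):
  start from disjoint forests with the maximum number of edges, let \<open>X\<close> collect all edges left
  unused by some family reachable through single edge exchanges; every forest spans \<open>X\<close> within
  \<open>X\<close>, and counting crossing edges of the partition into components of \<open>X\<close> forces the forests to
  be trees.

  Suppose a coloring uses more than \<open>|E(P)| + t (|P| - 2)\<close> colors for all \<open>P\<close> with \<open>|P| \<ge> 3\<close>.  As
  long as there are at least \<open>t\<close> more edges than colors, all partitions with three or more parts have
  slack, so the cut condition can only be tight for a bipartition.  Two tight bipartitions would
  make their common refinement violate the slack, so there is at most one; its \<open>t\<close> edges cannot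
  contain all edges of repeated color, and a repeated edge outside it can be deleted.  Eventually
  there are at most \<open>t - 1\<close> more edges than colors, and disjoint spanning trees can then be made
  rainbow one at a time by symmetric exchanges.

  For the lower bound, color all non-crossing edges and \<open>t (|P| - 2) - 1\<close> crossing edges with
  distinct colors, and all other edges with one further color: a rainbow spanning tree
  contains at least \<open>|P| - 2\<close> of the selected crossing edges.
\<close>

section \<open>Refinement of partitions\<close>

lemma refines_part_map:
  assumes "refines V P Q"
  obtains g where "g ` P = Q" "\<And>X. X \<in> P \<Longrightarrow> X \<subseteq> g X"
proof -
  obtain g where g: "\<And>X. X \<in> P \<Longrightarrow> g X \<in> Q \<and> X \<subseteq> g X"
    using assms unfolding refines_def by metis
  \<comment> \<open>A part \<open>Y\<close> of \<open>Q\<close> is nonempty, and by disjointness any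
    part of \<open>P\<close> that meets \<open>Y\<close> is sent to \<open>Y\<close>.\<close>
  have "Q \<subseteq> g ` P"
  proof
    fix Y assume Y: "Y \<in> Q"
    then obtain y where y: "y \<in> Y" "y \<in> V"
      using assms unfolding refines_def partition_on_def by (metis Union_iff equals0I)
    then obtain X where X: "X \<in> P" "y \<in> X"
      using assms unfolding refines_def partition_on_def by blast
    then have "y \<in> g X" "g X \<in> Q" using g by auto
    then have "g X = Y"
      using Y y assms unfolding refines_def partition_on_def disjoint_def by (metis IntI empty_iff)
    then show "Y \<in> g ` P" using X by blast
  qed
  then show thesis using g that[of g] by blast
qed

lemma card_refines_le:
  assumes "refines V P Q" "finite P"
  shows "card Q \<le> card P"
  using refines_part_map[OF assms(1)] assms(2) by (metis card_image_le)

text \<open>The surjection of parts becomes injective, so each coarse part contains a single fine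
  part and coincides with it.\<close>

lemma refines_card_eq:
  assumes "refines V P Q" "finite P" "card P \<le> card Q"
  shows "P = Q"
proof -
  obtain g where g: "g ` P = Q" "\<And>X. X \<in> P \<Longrightarrow> X \<subseteq> g X"
    using refines_part_map[OF assms(1)] by blast
  then have "card (g ` P) = card P"
    using assms(2,3) card_image_le[of P g] by simp
  then have inj: "inj_on g P"
    using assms(2) by (simp add: eq_card_imp_inj_on)
  have "refines V Q P"
    unfolding refines_def
  proof (intro conjI ballI)
    fix Y assume "Y \<in> Q"
    then obtain X where X: "X \<in> P" "Y = g X" using g(1) by blast
    have "y \<in> X" if "y \<in> Y" for y
    proof -
      have "y \<in> V" using that \<open>Y \<in> Q\<close> assms(1) unfolding refines_def partition_on_def by blast
      then obtain X' where X': "X' \<in> P" "y \<in> X'"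
        using assms(1) unfolding refines_def partition_on_def by blast
      then have "y \<in> g X'" "g X' \<in> Q" using g by auto
      then have "g X' = g X"
        using that X(2) \<open>Y \<in> Q\<close> assms(1) unfolding refines_def partition_on_def disjoint_def
        by (metis IntI empty_iff)
      then show ?thesis using inj X X' by (metis inj_onD)
    qed
    then show "\<exists>X\<in>P. Y \<subseteq> X" using X by blast
  qed (use assms(1) in \<open>auto simp: refines_def\<close>)
  then show ?thesis using assms(1) refines_asym by blast
qed

section \<open>The cycle matroid\<close>

definition conn :: "('v, 'e) multigraph \<Rightarrow> 'e set \<Rightarrow> ('v \<times> 'v) set" where
  "conn G A = (adj_rel G A)\<^sup>*"

text \<open>The product avoids naming the two ends and treats loops uniformly: by reflexivity of
  \<open>conn\<close>, every loop of \<open>G\<close> lies in every closure.\<close>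

definition cl :: "('v, 'e) multigraph \<Rightarrow> 'e set \<Rightarrow> 'e set" where
  "cl G A = {e \<in> edges G. ends G e \<times> ends G e \<subseteq> conn G A}"

definition indep :: "('v, 'e) multigraph \<Rightarrow> 'e set \<Rightarrow> bool" where
  "indep G A \<longleftrightarrow> A \<subseteq> edges G \<and> (\<forall>e\<in>A. e \<notin> cl G (A - {e}))"

text \<open>\<open>conn\<close> is reflexive on the whole vertex type, so it is restricted to
  \<open>verts G\<close> before its classes are formed.\<close>

definition comps :: "('v, 'e) multigraph \<Rightarrow> 'e set \<Rightarrow> 'v set set" where
  "comps G A = verts G // (conn G A \<inter> verts G \<times> verts G)"

definition crossing :: "'v set set \<Rightarrow> ('v, 'e) multigraph \<Rightarrow> 'e set \<Rightarrow> 'e set" where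
  "crossing P G A = {e \<in> A. \<not> (\<exists>X\<in>P. ends G e \<subseteq> X)}"

lemma conn_refl [simp]: "(u, u) \<in> conn G A"
  by (simp add: conn_def)

lemma conn_sym: "(u, v) \<in> conn G A \<Longrightarrow> (v, u) \<in> conn G A"
proof -
  have "sym (adj_rel G A)"
    unfolding sym_def adj_rel_def by (auto simp: insert_commute)
  then show "(u, v) \<in> conn G A \<Longrightarrow> (v, u) \<in> conn G A"
    unfolding conn_def by (metis sym_rtrancl symD)
qed

lemma conn_trans: "(u, v) \<in> conn G A \<Longrightarrow> (v, w) \<in> conn G A \<Longrightarrow> (u, w) \<in> conn G A"
  by (simp add: conn_def)

lemma conn_mono: "A \<subseteq> B \<Longrightarrow> conn G A \<subseteq> conn G B"
  unfolding conn_def adj_rel_def by (intro rtrancl_mono) auto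

lemma conn_edge: "e \<in> A \<Longrightarrow> ends G e = {u, v} \<Longrightarrow> (u, v) \<in> conn G A"
  unfolding conn_def adj_rel_def by blast

lemma conn_subset:
  assumes "A \<subseteq> cl G B"
  shows "conn G A \<subseteq> conn G B"
proof -
  have "adj_rel G A \<subseteq> conn G B"
    using assms unfolding adj_rel_def cl_def by auto
  then show ?thesis
    unfolding conn_def by (rule rtrancl_subset_rtrancl)
qed

lemma cl_mono: "A \<subseteq> B \<Longrightarrow> cl G A \<subseteq> cl G B"
  using conn_mono unfolding cl_def by blast

lemma cl_subset_cl: "A \<subseteq> cl G B \<Longrightarrow> cl G A \<subseteq> cl G B"
  using conn_subset unfolding cl_def by blast

lemma cl_iff:
  assumes "e \<in> edges G" "ends G e = {u, v}"
  shows "e \<in> cl G A \<longleftrightarrow> (u, v) \<in> conn G A"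
  using assms conn_sym[of u v G A] unfolding cl_def by auto

text \<open>A walk can be shortened until it passes \<open>f\<close> at most once, in one of the two
  directions.\<close>

lemma conn_insert_cases:
  assumes "(x, y) \<in> conn G (insert f A)" "ends G f = {u, v}"
  shows "(x, y) \<in> conn G A \<or> (x, u) \<in> conn G A \<and> (v, y) \<in> conn G A
    \<or> (x, v) \<in> conn G A \<and> (u, y) \<in> conn G A"
  using assms(1) unfolding conn_def
proof (induction rule: rtrancl_induct)
  case base
  then show ?case by simp
next
  case (step y z)
  from step.hyps(2) consider "(y, z) \<in> adj_rel G A" | "{y, z} = {u, v}"
    unfolding adj_rel_def using assms(2) by auto
  then show ?case
  proof cases
    case 1
    then show ?thesis using step.IH by (meson rtrancl.rtrancl_into_rtrancl)
  next
    case 2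
    then have "y = u \<and> z = v \<or> y = v \<and> z = u" by (auto simp: doubleton_eq_iff)
    then show ?thesis using step.IH by auto
  qed
qed

lemma indep_subset:
  assumes "indep G A" "B \<subseteq> A"
  shows "indep G B"
proof -
  have "cl G (B - {e}) \<subseteq> cl G (A - {e})" for e
    using assms(2) by (intro cl_mono) blast
  then show ?thesis using assms unfolding indep_def by blast
qed

locale fin_multigraph =
  fixes G :: "('v, 'e) multigraph"
  assumes fin: "finite_multigraph G"
begin

lemma finite_verts: "finite (verts G)" and verts_ne: "verts G \<noteq> {}"
  and finite_edges: "finite (edges G)"
  using fin unfolding finite_multigraph_def by auto

lemma finite_subset_edges: "A \<subseteq> edges G \<Longrightarrow> finite A"
  using finite_edges finite_subset by blast

lemma edge_ends:
  assumes "e \<in> edges G"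
  obtains u v where "ends G e = {u, v}" "u \<in> verts G" "v \<in> verts G"
proof -
  have s: "ends G e \<subseteq> verts G" "card (ends G e) = 1 \<or> card (ends G e) = 2"
    using fin assms unfolding finite_multigraph_def by auto
  then obtain u v where "ends G e = {u, v}"
    by (metis card_1_singletonE card_2_iff insert_absorb2)
  then show ?thesis using that s(1) by auto
qed

lemma subset_cl:
  assumes "A \<subseteq> edges G"
  shows "A \<subseteq> cl G A"
proof
  fix e assume e: "e \<in> A"
  then obtain u v where "ends G e = {u, v}" using assms edge_ends by blast
  then show "e \<in> cl G A" using e assms cl_iff conn_edge by (metis subsetD)
qed

text \<open>A walk joining the ends of \<open>e\<close> must pass through \<open>f\<close>, so the
  ends of \<open>f\<close> are linked within \<open>A\<close> to those of \<open>e\<close>, and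
  \<open>e\<close> closes the connection between them. This is the exchange property of the
  matroid.\<close>

lemma cl_exchange:
  assumes "e \<in> cl G (insert f A)" "e \<notin> cl G A" "f \<in> edges G"
  shows "f \<in> cl G (insert e A)"
proof -
  have e: "e \<in> edges G" using assms(1) by (simp add: cl_def)
  obtain x y where xy: "ends G e = {x, y}" using e edge_ends by blast
  obtain u v where uv: "ends G f = {u, v}" using assms(3) edge_ends by blast
  have "(x, y) \<in> conn G (insert f A)" "(x, y) \<notin> conn G A"
    using assms(1,2) cl_iff[OF e xy] by auto
  then have *: "(x, u) \<in> conn G A \<and> (v, y) \<in> conn G A \<or> (x, v) \<in> conn G A \<and> (u, y) \<in> conn G A"
    using conn_insert_cases[OF _ uv, of x y A] by simp
  have sub: "conn G A \<subseteq> conn G (insert e A)" by (rule conn_mono) auto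
  have "(x, y) \<in> conn G (insert e A)" using conn_edge xy by (metis insertI1)
  then have "(u, v) \<in> conn G (insert e A)"
    using * sub by (meson conn_sym conn_trans subsetD)
  then show ?thesis using cl_iff[OF assms(3) uv] by simp
qed

lemma indep_insert:
  assumes "indep G F" "e \<in> edges G" "e \<notin> cl G F"
  shows "indep G (insert e F)"
  unfolding indep_def
proof (intro conjI ballI)
  show "insert e F \<subseteq> edges G" using assms unfolding indep_def by auto
  have "e \<notin> F" using assms subset_cl unfolding indep_def by blast
  fix f assume f: "f \<in> insert e F"
  show "f \<notin> cl G (insert e F - {f})"
  proof (cases "f = e")
    case True
    then show ?thesis using assms(3) \<open>e \<notin> F\<close> by simp
  next
    case False
    then have "f \<in> F" using f by simp
    show ?thesis
    proof
      assume "f \<in> cl G (insert e F - {f})"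
      then have "f \<in> cl G (insert e (F - {f}))" using False by (simp add: insert_Diff_if)
      moreover have "f \<notin> cl G (F - {f})" using assms(1) \<open>f \<in> F\<close> unfolding indep_def by blast
      ultimately have "e \<in> cl G (insert f (F - {f}))" using cl_exchange assms(2) by blast
      then show False using assms(3) \<open>f \<in> F\<close> by (simp add: insert_absorb)
    qed
  qed
qed

lemma indep_swap:
  assumes "indep G F" "e \<in> edges G" "e \<notin> cl G (F - {f})"
  shows "indep G (insert e (F - {f}))"
  using assms indep_insert indep_subset by (metis Diff_subset)

text \<open>The set below is the fundamental circuit of \<open>e\<close> with respect to \<open>F\<close>, without \<open>e\<close>.\<close>

lemma mem_cl_fundamental_circuit:
  assumes "indep G F" "e \<in> cl G F"
  shows "e \<in> cl G {f \<in> F. e \<notin> cl G (F - {f})}"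
proof -
  have FE: "F \<subseteq> edges G" using assms(1) unfolding indep_def by simp
  then have "finite F" by (rule finite_subset_edges)
  \<comment> \<open>\<open>D\<close> is an inclusion-minimal subset of \<open>F\<close> that spans
    \<open>e\<close>.\<close>
  then obtain D where D: "D \<subseteq> F" "e \<in> cl G D" "\<And>D'. D' \<subset> D \<Longrightarrow> e \<notin> cl G D'"
    using assms(2)
  proof (induction F arbitrary: thesis rule: finite_psubset_induct)
    case (psubset F)
    show ?case
    proof (cases "\<exists>D'. D' \<subset> F \<and> e \<in> cl G D'")
      case True
      then show ?thesis using psubset.IH psubset.prems(1) by (metis psubset_imp_subset subset_trans)
    next
      case False
      then show ?thesis using psubset.prems by blast
    qed
  qed
  \<comment> \<open>Minimality of \<open>D\<close> and exchange put \<open>f\<close> into the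
    closure of \<open>e\<close> and \<open>D - {f}\<close>. If \<open>F - {f}\<close> spanned
    \<open>e\<close>, it would therefore span \<open>f\<close> too, against independence.\<close>
  have "e \<notin> cl G (F - {f})" if f: "f \<in> D" for f
  proof
    assume a: "e \<in> cl G (F - {f})"
    have "f \<in> cl G (insert e (D - {f}))"
      using cl_exchange[of e f "D - {f}"] D f FE by (simp add: insert_absorb psubset_eq subset_iff) blast
    moreover have "insert e (D - {f}) \<subseteq> cl G (F - {f})"
      using a D(1) subset_cl[of "F - {f}"] FE by blast
    ultimately have "f \<in> cl G (F - {f})" using cl_subset_cl by blast
    then show False using assms(1) f D(1) unfolding indep_def by blast
  qed
  then have "D \<subseteq> {f \<in> F. e \<notin> cl G (F - {f})}" using D(1) by auto
  then show ?thesis using D(2) cl_mono by blast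
qed

section \<open>Connected components and the rank of forests\<close>

lemma equiv_comps: "equiv (verts G) (conn G A \<inter> verts G \<times> verts G)"
proof (intro equivI refl_onI symI transI)
  fix x y z
  assume "(x, y) \<in> conn G A \<inter> verts G \<times> verts G" "(y, z) \<in> conn G A \<inter> verts G \<times> verts G"
  then show "(x, z) \<in> conn G A \<inter> verts G \<times> verts G" using conn_trans[of x y G A z] by blast
next
  fix x y
  assume "(x, y) \<in> conn G A \<inter> verts G \<times> verts G"
  then show "(y, x) \<in> conn G A \<inter> verts G \<times> verts G" using conn_sym[of x y G A] by blast
qed auto

lemma partition_comps: "partition_on (verts G) (comps G A)"
  unfolding comps_def using equiv_comps by (rule partition_on_quotient)

lemma finite_partition: "partition_on (verts G) P \<Longrightarrow> finite P"
  using finite_verts by (metis finite_UnionD partition_on_def)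

lemma card_comps_empty: "card (comps G {}) = card (verts G)"
proof -
  have "conn G {} = Id" unfolding conn_def adj_rel_def by simp
  then have "comps G {} = (\<lambda>x. {x}) ` verts G"
    unfolding comps_def quotient_def by auto
  then show ?thesis by (simp add: card_image)
qed

text \<open>The new edge joins two different classes; it merges exactly these and leaves every other
  class as it was.\<close>

lemma card_comps_insert:
  assumes e: "e \<in> edges G" and n: "e \<notin> cl G A"
  shows "card (comps G A) = Suc (card (comps G (insert e A)))"
proof -
  obtain u v where uv: "ends G e = {u, v}" "u \<in> verts G" "v \<in> verts G" using e edge_ends by blast
  define r where "r = conn G A \<inter> verts G \<times> verts G"
  define r' where "r' = conn G (insert e A) \<inter> verts G \<times> verts G"
  have r: "equiv (verts G) r" and r': "equiv (verts G) r'"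
    unfolding r_def r'_def by (rule equiv_comps)+
  have nuv: "(u, v) \<notin> conn G A" using cl_iff[OF e uv(1)] n by simp
  have uv': "(u, v) \<in> conn G (insert e A)" using conn_edge uv by (metis insertI1)
  have sub: "conn G A \<subseteq> conn G (insert e A)" by (rule conn_mono) auto
  have cls: "r' `` {x} = (if x \<in> r `` {u} \<union> r `` {v} then r `` {u} \<union> r `` {v} else r `` {x})"
    if x: "x \<in> verts G" for x
  proof -
    have "(x, y) \<in> conn G (insert e A) \<longleftrightarrow> (if (u, x) \<in> conn G A \<or> (v, x) \<in> conn G A
      then (u, y) \<in> conn G A \<or> (v, y) \<in> conn G A else (x, y) \<in> conn G A)" for y
      using conn_insert_cases[OF _ uv(1), of x y] sub uv' conn_sym conn_trans
      by (smt (verit, ccfv_threshold) subsetD)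
    then show ?thesis using x uv unfolding r_def r'_def by auto
  qed
  have "comps G (insert e A) = (\<lambda>x. r' `` {x}) ` verts G"
    unfolding comps_def quotient_def r'_def by auto
  also have "\<dots> = insert (r `` {u} \<union> r `` {v}) (comps G A - {r `` {u}, r `` {v}})"
  proof (intro set_eqI iffI)
    fix X assume "X \<in> (\<lambda>x. r' `` {x}) ` verts G"
    then obtain x where x: "x \<in> verts G" "X = r' `` {x}" by blast
    show "X \<in> insert (r `` {u} \<union> r `` {v}) (comps G A - {r `` {u}, r `` {v}})"
    proof (cases "x \<in> r `` {u} \<union> r `` {v}")
      case True
      then show ?thesis using cls x by auto
    next
      case False
      then have "X = r `` {x}" using cls x by auto
      moreover have "x \<in> r `` {x}" using equiv_class_self[OF r] x by simp
      ultimately show ?thesis using False x unfolding comps_def r_def[symmetric]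
        by (auto intro: quotientI)
    qed
  next
    fix X assume X: "X \<in> insert (r `` {u} \<union> r `` {v}) (comps G A - {r `` {u}, r `` {v}})"
    have "u \<in> r `` {u}" using equiv_class_self[OF r] uv by simp
    then have uu: "r' `` {u} = r `` {u} \<union> r `` {v}" using cls[of u] uv by auto
    show "X \<in> (\<lambda>x. r' `` {x}) ` verts G"
    proof (cases "X = r `` {u} \<union> r `` {v}")
      case True
      then show ?thesis using uu uv by blast
    next
      case False
      then obtain x where x: "x \<in> verts G" "X = r `` {x}" "X \<noteq> r `` {u}" "X \<noteq> r `` {v}"
        using X unfolding comps_def r_def[symmetric] by (metis DiffE insertCI insertE quotientE)
      then have "x \<notin> r `` {u} \<union> r `` {v}"
        using r by (metis Image_singleton_iff UnE equiv_class_eq)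
      then show ?thesis using cls x by auto
    qed
  qed
  finally have eq: "comps G (insert e A) = insert (r `` {u} \<union> r `` {v}) (comps G A - {r `` {u}, r `` {v}})" .
  have in': "r `` {u} \<in> comps G A" "r `` {v} \<in> comps G A"
    unfolding comps_def r_def[symmetric] using uv by (auto intro: quotientI)
  have neq: "r `` {u} \<noteq> r `` {v}"
    using nuv equiv_class_self[OF r uv(3)] unfolding r_def by blast
  have "r `` {u} \<union> r `` {v} \<notin> comps G A - {r `` {u}, r `` {v}}"
  proof
    assume a: "r `` {u} \<union> r `` {v} \<in> comps G A - {r `` {u}, r `` {v}}"
    have "u \<in> r `` {u}" using equiv_class_self[OF r] uv by simp
    then have "r `` {u} \<union> r `` {v} = r `` {u}"
      using a in' quotient_disj[OF r] unfolding comps_def r_def[symmetric] by blast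
    then show False using a by simp
  qed
  moreover have f: "finite (comps G A)" using finite_partition partition_comps by blast
  moreover have "card (comps G A) = Suc (Suc (card (comps G A - {r `` {u}, r `` {v}})))"
  proof -
    have "card {r `` {u}, r `` {v}} \<le> card (comps G A)" using in' f by (intro card_mono) auto
    then show ?thesis using in' neq f by (simp add: card_Diff_subset)
  qed
  ultimately show ?thesis unfolding eq by simp
qed

text \<open>The rank formula for forests: starting from isolated vertices, each added edge lowers
  the number of components by one.\<close>

lemma indep_card_comps:
  assumes "indep G A"
  shows "card A + card (comps G A) = card (verts G)"
proof -
  have "finite A" using assms finite_subset_edges unfolding indep_def by blast
  then show ?thesis using assms
  proof (induction A rule: finite_induct)
    case empty
    then show ?case by (simp add: card_comps_empty)
  next
    case (insert e A)
    have "indep G A" using insert.prems indep_subset by blast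
    moreover have "e \<in> edges G" "e \<notin> cl G A"
      using insert unfolding indep_def by auto
    ultimately show ?case using insert card_comps_insert by simp
  qed
qed

lemma card_comps_pos: "card (comps G A) > 0"
  using finite_partition[OF partition_comps] verts_ne
  by (simp add: card_gt_0_iff comps_def)

lemma spanning_connected_iff_card_comps:
  "spanning_connected G A \<longleftrightarrow> card (comps G A) = 1"
proof
  assume sc: "spanning_connected G A"
  have "comps G A \<subseteq> {verts G}"
    using sc unfolding spanning_connected_def comps_def conn_def quotient_def by auto
  then have "card (comps G A) \<le> 1"
    using card_mono[of "{verts G}" "comps G A"] by simp
  then show "card (comps G A) = 1" using card_comps_pos[of A] by linarith
next
  assume "card (comps G A) = 1"
  then obtain X where "comps G A = {X}" by (auto simp: card_1_singleton_iff)
  then have "comps G A = {verts G}" using partition_comps[of A] by (simp add: partition_on_def)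
  then show "spanning_connected G A"
    unfolding spanning_connected_def comps_def
    using equiv_comps[of A] in_quotient_imp_in_rel[OF equiv_comps, of "verts G" A]
    unfolding conn_def by auto
qed

lemma indep_spanning_connected_iff:
  assumes "indep G A"
  shows "spanning_connected G A \<longleftrightarrow> Suc (card A) = card (verts G)"
  unfolding spanning_connected_iff_card_comps using indep_card_comps[OF assms] by linarith

lemma indep_card_less:
  assumes "indep G A"
  shows "card A < card (verts G)"
  using indep_card_comps[OF assms] card_comps_pos[of A] by linarith

text \<open>The last edge \<open>f\<close> of a cycle joins the ends of the path formed by the other
  edges, so it lies in their closure; for a loop this path is trivial.\<close>

lemma indep_acyclic:
  assumes "indep G T"
  shows "acyclic_edges G T"
  unfolding acyclic_edges_def
proof (intro notI, elim exE conjE)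
  fix vs es assume es: "set es \<subseteq> T" and cyc: "is_cycle G vs es"
  define k where "k = length es - 1"
  have len: "length es = Suc k" using cyc unfolding is_cycle_def k_def by (cases es) auto
  have en: "ends G (es ! i) = {vs ! i, vs ! (Suc i mod Suc k)}" if "i \<le> k" for i
    using cyc that len unfolding is_cycle_def by simp
  have d: "distinct es" using cyc unfolding is_cycle_def by simp
  define f where "f = es ! k"
  have f: "f \<in> T" using es len unfolding f_def by auto
  have "(vs ! 0, vs ! j) \<in> conn G (T - {f})" if "j \<le> k" for j
    using that
  proof (induction j)
    case 0
    then show ?case by simp
  next
    case (Suc j)
    have "es ! j \<in> T - {f}"
      using es len d Suc.prems unfolding f_def by (auto simp: nth_eq_iff_index_eq)
    moreover have "ends G (es ! j) = {vs ! j, vs ! Suc j}" using en[of j] Suc.prems by simp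
    ultimately have "(vs ! j, vs ! Suc j) \<in> conn G (T - {f})" by (rule conn_edge)
    then show ?case using Suc by (meson Suc_leD conn_trans)
  qed
  then have "(vs ! 0, vs ! k) \<in> conn G (T - {f})" by simp
  moreover have "ends G f = {vs ! 0, vs ! k}" using en[of k] unfolding f_def by auto
  moreover have "f \<in> edges G" using f assms unfolding indep_def by blast
  ultimately have "f \<in> cl G (T - {f})" using cl_iff[of f G "vs ! 0" "vs ! k"] by simp
  then show False using f assms unfolding indep_def by blast
qed

lemma indep_spanning_tree:
  assumes "indep G T" "Suc (card T) = card (verts G)"
  shows "spanning_tree G T"
  unfolding spanning_tree_def
  using assms indep_acyclic[OF assms(1)] indep_spanning_connected_iff[OF assms(1)]
  by (simp add: indep_def)

text \<open>Deleting an edge spanned by the others preserves connectivity; this is repeated until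
  the set is independent.\<close>

lemma spanning_connected_indep_subset:
  assumes "T \<subseteq> edges G" "spanning_connected G T"
  obtains B where "B \<subseteq> T" "indep G B" "spanning_connected G B"
proof -
  have "finite T" using assms(1) by (rule finite_subset_edges)
  then show ?thesis using assms that
  proof (induction T arbitrary: thesis rule: finite_psubset_induct)
    case (psubset T)
    show ?case
    proof (cases "indep G T")
      case True
      then show ?thesis using psubset.prems by blast
    next
      case False
      then obtain e where e: "e \<in> T" "e \<in> cl G (T - {e})"
        using psubset.prems(1) unfolding indep_def by blast
      have "T - {e} \<subseteq> cl G (T - {e})" using psubset.prems(1) by (intro subset_cl) auto
      then have "conn G T \<subseteq> conn G (T - {e})" using e by (intro conn_subset) blast
      then have "spanning_connected G (T - {e})"
        using psubset.prems(2) unfolding spanning_connected_def conn_def by blast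
      moreover have "T - {e} \<subset> T" using e by blast
      ultimately obtain B where "B \<subseteq> T - {e}" "indep G B" "spanning_connected G B"
        using psubset.IH[of "T - {e}"] psubset.prems(1) by blast
      then show ?thesis using psubset.prems(3)[of B] by blast
    qed
  qed
qed

section \<open>Crossing edges of connected spanning sets\<close>

lemma comps_refines:
  assumes P: "partition_on (verts G) P" and A: "A \<subseteq> edges G" "crossing P G A = {}"
  shows "refines (verts G) (comps G A) P"
  unfolding refines_def
proof (intro conjI ballI partition_comps P)
  fix X assume "X \<in> comps G A"
  then obtain x where x: "x \<in> verts G" "X = (conn G A \<inter> verts G \<times> verts G) `` {x}"
    unfolding comps_def by (rule quotientE)
  then obtain Y where Y: "Y \<in> P" "x \<in> Y" using P unfolding partition_on_def by blast
  \<comment> \<open>No edge of \<open>A\<close> leaves a part of \<open>P\<close>, so a walk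
    starting in \<open>Y\<close> stays in \<open>Y\<close>.\<close>
  have "y \<in> Y" if "(x, y) \<in> conn G A" for y
    using that unfolding conn_def
  proof (induction rule: rtrancl_induct)
    case base
    then show ?case using Y by simp
  next
    case (step y z)
    then obtain e where e: "e \<in> A" "ends G e = {y, z}" unfolding adj_rel_def by blast
    then obtain Z where Z: "Z \<in> P" "{y, z} \<subseteq> Z" using A(2) unfolding crossing_def by auto
    then have "Z = Y" using step.IH Y P unfolding partition_on_def disjoint_def by blast
    then show ?case using Z by simp
  qed
  then show "\<exists>Y\<in>P. X \<subseteq> Y" using x Y by blast
qed

text \<open>The non-crossing edges \<open>N\<close> of a spanning tree \<open>B\<close> inside
  \<open>T\<close> leave at least \<open>card P\<close> components, so there are at most
  \<open>card (verts G) - card P\<close> of them. The other edges of \<open>B\<close> cross, and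
  they number at least \<open>card P - 1\<close>.\<close>

lemma card_crossing_spanning_connected:
  assumes P: "partition_on (verts G) P" and T: "T \<subseteq> edges G" "spanning_connected G T"
  shows "card P - 1 \<le> card (crossing P G T)"
proof -
  obtain B where B: "B \<subseteq> T" "indep G B" "spanning_connected G B"
    using T spanning_connected_indep_subset by blast
  define N where "N = B - crossing P G B"
  have NB: "N \<subseteq> B" and NE: "N \<subseteq> edges G" unfolding N_def using B T by auto
  have "crossing P G N = {}" unfolding N_def crossing_def by auto
  then have "card P \<le> card (comps G N)"
    using comps_refines[OF P NE] card_refines_le finite_partition partition_comps by blast
  moreover have "card N + card (comps G N) = card (verts G)"
    using B NB indep_subset indep_card_comps by blast
  moreover have "Suc (card B) = card (verts G)" using B indep_spanning_connected_iff by blast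
  moreover have "card B = card N + card (crossing P G B)"
  proof -
    have "crossing P G B \<subseteq> B" "finite B" using B T finite_subset_edges unfolding crossing_def by auto
    then show ?thesis unfolding N_def
      by (metis card_Diff_subset card_mono finite_subset le_add_diff_inverse2)
  qed
  moreover have "card (crossing P G B) \<le> card (crossing P G T)"
    using B T finite_subset_edges[of T] by (intro card_mono) (auto simp: crossing_def)
  ultimately show ?thesis by linarith
qed

end

section \<open>Packing spanning trees\<close>

definition forest_family :: "('v, 'e) multigraph \<Rightarrow> 'e set \<Rightarrow> nat \<Rightarrow> (nat \<Rightarrow> 'e set) \<Rightarrow> bool" where
  "forest_family G A t F \<longleftrightarrow>
     (\<forall>i<t. indep G (F i) \<and> F i \<subseteq> A) \<and> disjoint_family_on F {..<t}"

inductive_set exchanges ::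
  "('v, 'e) multigraph \<Rightarrow> 'e set \<Rightarrow> nat \<Rightarrow> (nat \<Rightarrow> 'e set) \<Rightarrow> (nat \<Rightarrow> 'e set) set"
  for G A t F\<^sub>0 where
  base: "F\<^sub>0 \<in> exchanges G A t F\<^sub>0"
| step: "F \<in> exchanges G A t F\<^sub>0 \<Longrightarrow> i < t \<Longrightarrow> e \<in> A - (\<Union>j<t. F j) \<Longrightarrow> f \<in> F i \<Longrightarrow>
    e \<notin> cl G (F i - {f}) \<Longrightarrow> F(i := insert e (F i - {f})) \<in> exchanges G A t F\<^sub>0"

lemma crossing_subset: "crossing P G A \<subseteq> A"
  by (auto simp: crossing_def)

lemma disjoint_family_on_fun_upd:
  assumes "disjoint_family_on F I" "i \<in> I" "X \<subseteq> insert e (F i)" "\<And>j. j \<in> I \<Longrightarrow> e \<notin> F j"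
  shows "disjoint_family_on (F(i := X)) I"
proof -
  have "X \<inter> F j = {}" if "j \<in> I" "j \<noteq> i" for j
    using disjoint_family_onD[OF assms(1,2) that(1)] that assms(3,4) by blast
  then show ?thesis
    using assms(1) unfolding disjoint_family_on_def by (auto simp: Int_commute)
qed

context fin_multigraph
begin

lemma exchanges_forest_family:
  assumes F\<^sub>0: "forest_family G A t F\<^sub>0" and A: "A \<subseteq> edges G" and F: "F \<in> exchanges G A t F\<^sub>0"
  shows "forest_family G A t F \<and> (\<Sum>i<t. card (F i)) = (\<Sum>i<t. card (F\<^sub>0 i))"
  using F
proof induction
  case base
  then show ?case using F\<^sub>0 by simp
next
  case (step F i e f)
  have ff: "forest_family G A t F" using step.IH by simp
  have e: "e \<in> A" "\<And>j. j < t \<Longrightarrow> e \<notin> F j" using step.hyps(3) by auto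
  have Fi: "indep G (F i)" "F i \<subseteq> A" using ff step.hyps(2) unfolding forest_family_def by auto
  have "finite (F i)" using Fi A finite_subset_edges by blast
  then have "card (insert e (F i - {f})) = card (F i)"
    using e(2) step.hyps(2,4) by (simp add: card_Suc_Diff1 del: card_Diff_insert)
  then have "card ((F(i := insert e (F i - {f}))) j) = card (F j)" for j by simp
  then have "(\<Sum>j<t. card ((F(i := insert e (F i - {f}))) j)) = (\<Sum>j<t. card (F j))" by presburger
  moreover have "indep G (insert e (F i - {f}))"
    using indep_swap[OF Fi(1) _ step.hyps(5)] e(1) A by blast
  moreover have "disjoint_family_on (F(i := insert e (F i - {f}))) {..<t}"
    using ff e(2) step.hyps(2) unfolding forest_family_def
    by (intro disjoint_family_on_fun_upd[where e = e]) auto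
  ultimately show ?case
    using step.IH e(1) Fi unfolding forest_family_def by auto
qed

lemma forest_family_saturated:
  assumes F\<^sub>0: "forest_family G A t F\<^sub>0" and A: "A \<subseteq> edges G"
    and max: "\<And>F. forest_family G A t F \<Longrightarrow> (\<Sum>i<t. card (F i)) \<le> (\<Sum>i<t. card (F\<^sub>0 i))"
  obtains X where "X \<subseteq> A" "A - (\<Union>i<t. F\<^sub>0 i) \<subseteq> X" "\<And>i. i < t \<Longrightarrow> X \<subseteq> cl G (F\<^sub>0 i \<inter> X)"
proof -
  define X where "X = (\<Union>F\<in>exchanges G A t F\<^sub>0. A - (\<Union>i<t. F i))"
  have unused: "e \<in> cl G (F i \<inter> X)"
    if F: "F \<in> exchanges G A t F\<^sub>0" and e: "e \<in> A - (\<Union>j<t. F j)" and i: "i < t" for F e i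
  proof -
    have ff: "forest_family G A t F" and sum: "(\<Sum>i<t. card (F i)) = (\<Sum>i<t. card (F\<^sub>0 i))"
      using exchanges_forest_family[OF F\<^sub>0 A F] by auto
    have Fi: "indep G (F i)" "F i \<subseteq> A" using ff i unfolding forest_family_def by auto
    have "e \<in> cl G (F i)"
    proof (rule ccontr)
      assume n: "e \<notin> cl G (F i)"
      have "disjoint_family_on (F(i := insert e (F i))) {..<t}"
        using ff e i unfolding forest_family_def
        by (intro disjoint_family_on_fun_upd[where e = e]) auto
      moreover have "indep G (insert e (F i))" using indep_insert Fi e A n by blast
      ultimately have "forest_family G A t (F(i := insert e (F i)))"
        using ff e Fi unfolding forest_family_def by auto
      then have "(\<Sum>j<t. card ((F(i := insert e (F i))) j)) \<le> (\<Sum>j<t. card (F j))"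
        using max sum by metis
      moreover have "(\<Sum>j<t. card (F j)) < (\<Sum>j<t. card ((F(i := insert e (F i))) j))"
      proof (rule sum_strict_mono_ex1)
        have "finite (F i)" using Fi A finite_subset_edges by blast
        then have "card (F i) < card ((F(i := insert e (F i))) i)" using e i by simp
        then show "\<exists>j\<in>{..<t}. card (F j) < card ((F(i := insert e (F i))) j)" using i by blast
        show "\<forall>j\<in>{..<t}. card (F j) \<le> card ((F(i := insert e (F i))) j)"
          by (simp add: card_insert_le)
      qed simp
      ultimately show False by simp
    qed
    then have "e \<in> cl G {f \<in> F i. e \<notin> cl G (F i - {f})}"
      using mem_cl_fundamental_circuit Fi(1) by blast
    moreover have "{f \<in> F i. e \<notin> cl G (F i - {f})} \<subseteq> F i \<inter> X"
    proof
      fix f assume "f \<in> {f \<in> F i. e \<notin> cl G (F i - {f})}"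
      then have f: "f \<in> F i" "e \<notin> cl G (F i - {f})" by auto
      let ?F = "F(i := insert e (F i - {f}))"
      have "?F \<in> exchanges G A t F\<^sub>0" using exchanges.step[OF F i e f] .
      moreover have "f \<in> A - (\<Union>j<t. ?F j)"
      proof -
        have "f \<notin> ?F j" if "j < t" for j
        proof (cases "j = i")
          case True
          then show ?thesis using f e i by auto
        next
          case False
          then have "F i \<inter> F j = {}"
            using ff i that unfolding forest_family_def disjoint_family_on_def by simp
          then show ?thesis using False f by auto
        qed
        then show ?thesis using f Fi by blast
      qed
      ultimately have "f \<in> X" unfolding X_def by blast
      then show "f \<in> F i \<inter> X" using f by blast
    qed
    ultimately show ?thesis using cl_mono by blast
  qed
  have closure_le: "cl G (F i \<inter> X) \<subseteq> cl G (F\<^sub>0 i \<inter> X)" if "F \<in> exchanges G A t F\<^sub>0" "i < t" for F i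
    using that(1)
  proof induction
    case base
    then show ?case by simp
  next
    case (step F j e f)
    have sub: "F i \<inter> X \<subseteq> cl G (F i \<inter> X)"
      using A by (intro subset_cl) (auto simp: X_def)
    have "e \<in> cl G (F j \<inter> X)" using unused step.hyps by blast
    then have "(F(j := insert e (F j - {f}))) i \<inter> X \<subseteq> cl G (F i \<inter> X)"
      using sub by auto
    then show ?case using step.IH cl_subset_cl by blast
  qed
  show thesis
  proof (rule that)
    show "X \<subseteq> A" unfolding X_def by auto
    show "A - (\<Union>i<t. F\<^sub>0 i) \<subseteq> X" unfolding X_def using exchanges.base[of F\<^sub>0 G A t] by blast
    show "X \<subseteq> cl G (F\<^sub>0 i \<inter> X)" if "i < t" for i
      using unused[OF _ _ that] closure_le[OF _ that] unfolding X_def by blast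
  qed
qed

theorem tree_packing:
  assumes A: "A \<subseteq> edges G"
    and cuts: "\<And>P. partition_on (verts G) P \<Longrightarrow> t * (card P - 1) \<le> card (crossing P G A)"
  obtains T where "forest_family G A t T" "\<And>i. i < t \<Longrightarrow> Suc (card (T i)) = card (verts G)"
proof -
  have "forest_family G A t (\<lambda>_. {})"
    unfolding forest_family_def indep_def disjoint_family_on_def by simp
  moreover have "(\<Sum>i<t. card (F i)) \<le> t * card A" if "forest_family G A t F" for F
  proof -
    have "(\<Sum>i<t. card (F i)) \<le> (\<Sum>i<t. card A)"
      using that A finite_subset_edges unfolding forest_family_def by (intro sum_mono card_mono) auto
    then show ?thesis by simp
  qed
  ultimately have "\<exists>T. forest_family G A t T \<and>
      (\<forall>F. forest_family G A t F \<longrightarrow> (\<Sum>i<t. card (F i)) \<le> (\<Sum>i<t. card (T i)))"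
    by (intro ex_has_greatest_nat[where b = "Suc (t * card A)"]) (auto simp: less_Suc_eq_le)
  then obtain T where T: "forest_family G A t T"
    and max: "\<And>F. forest_family G A t F \<Longrightarrow> (\<Sum>i<t. card (F i)) \<le> (\<Sum>i<t. card (T i))"
    by blast
  obtain X where X: "X \<subseteq> A" "A - (\<Union>i<t. T i) \<subseteq> X" "\<And>i. i < t \<Longrightarrow> X \<subseteq> cl G (T i \<inter> X)"
    using forest_family_saturated[OF T A max] by blast
  have Ti: "indep G (T i)" "T i \<subseteq> A" if "i < t" for i
    using T that unfolding forest_family_def by auto
  have finA: "finite A" using A by (rule finite_subset_edges)
  let ?P = "comps G X"
  let ?n = "card (verts G)"
  \<comment> \<open>Each forest spans \<open>X\<close> by its edges within \<open>X\<close>, so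
    these have the same components as \<open>X\<close>.\<close>
  have cardTX: "card (T i \<inter> X) + card ?P = ?n" if i: "i < t" for i
  proof -
    have "conn G X = conn G (T i \<inter> X)"
      using conn_subset[OF X(3)[OF i]] conn_mono[of "T i \<inter> X" X G] by blast
    then have "?P = comps G (T i \<inter> X)" unfolding comps_def by simp
    moreover have "indep G (T i \<inter> X)" using Ti(1)[OF i] indep_subset by blast
    ultimately show ?thesis using indep_card_comps by simp
  qed
  have split: "card (T i - X) + ?n = card (T i) + card ?P" if i: "i < t" for i
  proof -
    have "finite (T i)" using Ti(2)[OF i] finA finite_subset by blast
    then have "card (T i) = card (T i \<inter> X) + card (T i - X)"
      by (simp add: card_Int_Diff)
    then show ?thesis using cardTX[OF i] by simp
  qed
  \<comment> \<open>Edges of \<open>X\<close> run inside components of \<open>X\<close>; hence every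
    crossing edge avoids \<open>X\<close> and belongs to some forest.\<close>
  have "crossing ?P G A \<subseteq> A - X"
  proof
    fix e assume e: "e \<in> crossing ?P G A"
    have "e \<notin> X"
    proof
      assume "e \<in> X"
      obtain u v where uv: "ends G e = {u, v}" "u \<in> verts G" "v \<in> verts G"
        using e A edge_ends unfolding crossing_def by blast
      then have "(u, v) \<in> conn G X" using \<open>e \<in> X\<close> conn_edge[OF _ uv(1)] by simp
      then have "ends G e \<subseteq> (conn G X \<inter> verts G \<times> verts G) `` {u}" using uv by auto
      moreover have "(conn G X \<inter> verts G \<times> verts G) `` {u} \<in> ?P"
        unfolding comps_def using uv(2) by (rule quotientI)
      ultimately show False using e unfolding crossing_def by blast
    qed
    then show "e \<in> A - X" using e unfolding crossing_def by blast
  qed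
  also have "A - X \<subseteq> (\<Union>i<t. T i - X)" using X(2) by blast
  finally have "card (crossing ?P G A) \<le> card (\<Union>i<t. T i - X)"
    using finA Ti(2) by (intro card_mono finite_UN_I) (auto intro: finite_subset)
  also have "\<dots> \<le> (\<Sum>i<t. card (T i - X))" by (rule card_UN_le) simp
  finally have le: "t * (card ?P - 1) \<le> (\<Sum>i<t. card (T i - X))"
    using cuts[OF partition_comps] by (meson le_trans)
  \<comment> \<open>Each forest has at most \<open>card ?P - 1\<close> edges outside
    \<open>X\<close>, while the cut condition for \<open>?P\<close> requires at least that many on
    average. Equality throughout makes every forest a spanning tree.\<close>
  have bound: "card (T i - X) \<le> card ?P - 1" if i: "i < t" for i
    using split[OF i] indep_card_less[OF Ti(1)[OF i]] by linarith
  have full: "card (T i - X) = card ?P - 1" if i: "i < t" for i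
  proof (rule ccontr)
    assume "card (T i - X) \<noteq> card ?P - 1"
    then have "card (T i - X) < card ?P - 1" using bound[OF i] by simp
    then have "(\<Sum>i<t. card (T i - X)) < (\<Sum>i<t. card ?P - 1)"
      using bound i by (intro sum_strict_mono_ex1) auto
    then show False using le by simp
  qed
  have "Suc (card (T i)) = ?n" if i: "i < t" for i
    using split[OF i] full[OF i] card_comps_pos[of X] by linarith
  then show thesis using T that by blast
qed

text \<open>If \<open>S - {a}\<close> spanned the whole fundamental circuit of \<open>a\<close> in
  \<open>T\<close>, it would span \<open>a\<close>. So some \<open>b\<close> on this circuit is not
  spanned by \<open>S - {a}\<close>, and it can be exchanged with \<open>a\<close> in both
  trees.\<close>

lemma tree_symmetric_exchange:
  assumes S: "indep G S" "Suc (card S) = card (verts G)"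
    and T: "indep G T" "Suc (card T) = card (verts G)"
    and a: "a \<in> S" "a \<notin> T"
  obtains b where "b \<in> T" "b \<notin> S"
    "indep G (insert a (T - {b}))" "Suc (card (insert a (T - {b}))) = card (verts G)"
    "indep G (insert b (S - {a}))" "Suc (card (insert b (S - {a}))) = card (verts G)"
proof -
  have SE: "S \<subseteq> edges G" and TE: "T \<subseteq> edges G" using S T unfolding indep_def by auto
  have fin: "finite S" "finite T" using SE TE finite_subset_edges by auto
  have "a \<in> cl G T"
  proof (rule ccontr)
    assume "a \<notin> cl G T"
    then have "indep G (insert a T)" using indep_insert T(1) a SE by blast
    then have "card (insert a T) < card (verts G)" by (rule indep_card_less)
    then show False using a fin T(2) by simp
  qed
  then have D: "a \<in> cl G {b \<in> T. a \<notin> cl G (T - {b})}" using mem_cl_fundamental_circuit T(1) by blast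
  have "a \<notin> cl G (S - {a})" using S(1) a unfolding indep_def by blast
  then have "\<not> {b \<in> T. a \<notin> cl G (T - {b})} \<subseteq> cl G (S - {a})" using D cl_subset_cl by blast
  then obtain b where b: "b \<in> T" "a \<notin> cl G (T - {b})" "b \<notin> cl G (S - {a})" by blast
  have "S - {a} \<subseteq> cl G (S - {a})" using SE by (intro subset_cl) blast
  then have bS: "b \<notin> S" using a b by blast
  show thesis
  proof (rule that[OF b(1) bS])
    show "indep G (insert a (T - {b}))" using indep_swap[OF T(1) _ b(2)] a SE by blast
    show "indep G (insert b (S - {a}))" using indep_swap[OF S(1) _ b(3)] b(1) TE by blast
    show "Suc (card (insert a (T - {b}))) = card (verts G)"
      using T(2) a b(1) fin by (simp add: card_Suc_Diff1 del: card_Diff_insert)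
    show "Suc (card (insert b (S - {a}))) = card (verts G)"
      using S(2) a bS fin by (simp add: card_Suc_Diff1 del: card_Diff_insert)
  qed
qed

end

section \<open>Rainbow spanning trees\<close>

text \<open>Edges outside \<open>R\<close> have private colors, and the nonempty \<open>R\<close>
  contributes at least one further color.\<close>

lemma card_image_repeated:
  assumes "finite A" and "R = {e \<in> A. \<exists>f\<in>A. f \<noteq> e \<and> c f = c e}" and "R \<noteq> {}"
  shows "card A < card (c ` A) + card R"
proof -
  have "inj_on c (A - R)" using assms(2) by (auto simp: inj_on_def)
  then have "card (c ` (A - R)) = card (A - R)" by (rule card_image)
  moreover have "c ` (A - R) \<inter> c ` R = {}"
  proof -
    have "c x \<noteq> c y" if "x \<in> A - R" "y \<in> R" for x y
    proof
      assume "c x = c y"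
      moreover have "x \<noteq> y" "y \<in> A" "x \<in> A" using that assms(2) by auto
      ultimately have "x \<in> R" unfolding assms(2) by auto
      then show False using that by blast
    qed
    then show ?thesis by blast
  qed
  moreover have "c ` A = c ` (A - R) \<union> c ` R" using assms(2) by auto
  ultimately have "card (c ` A) = card (A - R) + card (c ` R)"
    using assms(1,2) by (simp add: card_Un_disjoint)
  moreover have "card (c ` R) > 0" using assms by (simp add: card_gt_0_iff)
  moreover have "card A = card (A - R) + card R"
  proof -
    have "R \<subseteq> A" using assms(2) by blast
    then show ?thesis
      using assms(1) by (metis card_Diff_subset card_mono finite_subset le_add_diff_inverse2)
  qed
  ultimately show ?thesis by linarith
qed

context fin_multigraph
begin

section \<open>Deleting edges of repeated color\<close>

lemma two_cut_union:
  assumes A: "A \<subseteq> edges G"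
    and P: "partition_on (verts G) P" "card P = 2" and Q: "partition_on (verts G) Q" "card Q = 2"
    and neq: "P \<noteq> Q"
  obtains R where "partition_on (verts G) R" "card R \<ge> 3"
    "crossing R G A \<subseteq> crossing P G A \<union> crossing Q G A"
proof -
  define R where "R = common_refinement {P, Q}"
  have refP: "refines (verts G) R P" and refQ: "refines (verts G) R Q"
    unfolding R_def using P Q by (auto intro!: refines_common_refinement)
  then have part: "partition_on (verts G) R" by (simp add: refines_def)
  then have fin: "finite R" by (rule finite_partition)
  have "card R \<ge> 3"
  proof (rule ccontr)
    assume "\<not> card R \<ge> 3"
    then have "R = P" "R = Q"
      using refines_card_eq[OF refP fin] refines_card_eq[OF refQ fin] P Q by simp_all
    then show False using neq by simp
  qed
  moreover have "crossing R G A \<subseteq> crossing P G A \<union> crossing Q G A"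
  proof (rule subsetI, rule ccontr)
    fix e assume e: "e \<in> crossing R G A" "e \<notin> crossing P G A \<union> crossing Q G A"
    then have eA: "e \<in> A" unfolding crossing_def by simp
    obtain X Y where XY: "X \<in> P" "ends G e \<subseteq> X" "Y \<in> Q" "ends G e \<subseteq> Y"
      using e eA unfolding crossing_def by blast
    obtain u v where "ends G e = {u, v}" using eA A edge_ends by blast
    then have "X \<inter> Y \<noteq> {}" using XY by blast
    \<comment> \<open>The parts of a common refinement come from choice functions; this one picks
      \<open>X\<close> from \<open>P\<close> and \<open>Y\<close> from \<open>Q\<close>, and
      \<open>neq\<close> keeps the two choices apart.\<close>
    moreover have "X \<inter> Y \<in> (\<Union>f \<in> (\<Pi> S\<in>{P, Q}. S). {\<Inter> (f ` {P, Q})})"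
      using XY neq by (intro UN_I[of "\<lambda>S. if S = P then X else Y"]) auto
    ultimately have "X \<inter> Y \<in> R" unfolding R_def common_refinement by blast
    then show False using e XY unfolding crossing_def by blast
  qed
  ultimately show thesis using that part by blast
qed

text \<open>Edges whose color recurs are deleted one by one until fewer than \<open>t\<close> edges
  exceed the number of colors. The colors stay the same, and each deleted edge avoids the tight
  bipartition, if there is one, so both families of inequalities survive.\<close>

lemma reduce_repeated_colors:
  fixes c :: "'e \<Rightarrow> 'c"
  assumes "A \<subseteq> edges G"
    and "t > 0"
    and "\<And>P. partition_on (verts G) P \<Longrightarrow> t * (card P - 1) \<le> card (crossing P G A)"
    and "\<And>P. partition_on (verts G) P \<Longrightarrow> 3 \<le> card P \<Longrightarrow>
           card (A - crossing P G A) + t * (card P - 2) < card (c ` A)"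
  obtains B where "B \<subseteq> A" "card B < card (c ` B) + t"
    "\<And>P. partition_on (verts G) P \<Longrightarrow> t * (card P - 1) \<le> card (crossing P G B)"
proof -
  have "finite A" using assms(1) by (rule finite_subset_edges)
  then show thesis using assms that
  proof (induction A arbitrary: thesis rule: finite_psubset_induct)
    case (psubset A)
    note cuts = psubset.prems(3) and large = psubset.prems(4)
    show ?case
    proof (cases "card A < card (c ` A) + t")
      case True
      then show ?thesis using psubset.prems(5)[of A] cuts by blast
    next
      case False
      have fin: "finite (crossing P G A)" for P
        using psubset.hyps crossing_subset[of P G A] by (rule finite_subset[rotated])
      \<comment> \<open>With at least \<open>t\<close> more edges than colors, the bound on
        non-crossing edges leaves more than \<open>t * (card P - 1)\<close> crossing ones.\<close>
      have slack: "t * (card P - 1) < card (crossing P G A)"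
        if P: "partition_on (verts G) P" "3 \<le> card P" for P
      proof -
        have "card A = card (A - crossing P G A) + card (crossing P G A)"
          using fin crossing_subset[of P G A] psubset.hyps
          by (metis card_Diff_subset card_mono le_add_diff_inverse2)
        moreover have "t * (card P - 1) = t * (card P - 2) + t"
        proof -
          have "card P - 1 = Suc (card P - 2)" using P(2) by simp
          then show ?thesis by simp
        qed
        ultimately show ?thesis using large[OF P] False by linarith
      qed
      \<comment> \<open>\<open>K\<close> is the crossing set of the only tight bipartition, or empty
        if there is none.\<close>
      obtain K where K: "card K \<le> t" "finite K"
        "\<And>P. partition_on (verts G) P \<Longrightarrow> card P = 2 \<Longrightarrow> card (crossing P G A) \<le> t \<Longrightarrow> crossing P G A \<subseteq> K"
      proof (cases "\<exists>P. partition_on (verts G) P \<and> card P = 2 \<and> card (crossing P G A) \<le> t")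
        case True
        then obtain P where P: "partition_on (verts G) P" "card P = 2" "card (crossing P G A) \<le> t" by blast
        have "Q = P" if Q: "partition_on (verts G) Q" "card Q = 2" "card (crossing Q G A) \<le> t" for Q
        proof (rule ccontr)
          assume "Q \<noteq> P"
          then obtain R where R: "partition_on (verts G) R" "card R \<ge> 3"
            "crossing R G A \<subseteq> crossing Q G A \<union> crossing P G A"
            using two_cut_union[OF psubset.prems(1) Q(1,2) P(1,2)] by blast
          have "card (crossing R G A) \<le> card (crossing Q G A \<union> crossing P G A)"
            using R(3) fin by (intro card_mono) auto
          also have "\<dots> \<le> card (crossing Q G A) + card (crossing P G A)" by (rule card_Un_le)
          \<comment> \<open>Two tight bipartitions have at most \<open>2 * t\<close> crossing edges
            together, but a partition with three or more parts has more than that.\<close>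
          finally have "card (crossing R G A) \<le> t * 2" using P(3) Q(3) by linarith
          moreover have "t * 2 \<le> t * (card R - 1)" using R(2) by (intro mult_le_mono2) linarith
          ultimately show False using slack[OF R(1,2)] by linarith
        qed
        then show thesis using that[of "crossing P G A"] P fin by blast
      next
        case False
        then show thesis using that[of "{}"] by auto
      qed
      define R where "R = {e \<in> A. \<exists>f\<in>A. f \<noteq> e \<and> c f = c e}"
      have "R \<noteq> {}"
      proof
        assume "R = {}"
        then have "inj_on c A" unfolding R_def by (auto simp: inj_on_def)
        then have "card (c ` A) = card A" by (rule card_image)
        then show False using False psubset.prems(2) by simp
      qed
      \<comment> \<open>A surplus of \<open>t\<close> edges over colors needs more than
        \<open>t\<close> edges of repeated color, too many for \<open>K\<close>.\<close>
      have "\<not> R \<subseteq> K"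
      proof
        assume "R \<subseteq> K"
        then have "card R \<le> t" using card_mono[OF K(2)] K(1) by (meson le_trans)
        then show False using card_image_repeated[OF psubset.hyps R_def \<open>R \<noteq> {}\<close>] False by linarith
      qed
      then obtain e f where e: "e \<in> A" "e \<notin> K" and f: "f \<in> A" "f \<noteq> e" "c f = c e"
        unfolding R_def by blast
      let ?B = "A - {e}"
      have "c e \<in> c ` ?B" using f by (metis DiffI image_eqI singletonD)
      then have img: "c ` ?B = c ` A" by blast
      have cr: "crossing P G ?B = crossing P G A - {e}" for P unfolding crossing_def by auto
      have cutsB: "t * (card P - 1) \<le> card (crossing P G ?B)" if P: "partition_on (verts G) P" for P
      proof (cases "e \<in> crossing P G A")
        case False
        then show ?thesis using cuts[OF P] cr by simp
      next
        case True
        \<comment> \<open>A cut that loses \<open>e\<close> must have an edge to spare: at most one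
          part demands nothing, a tight bipartition has its crossing edges in \<open>K\<close>, and
          three or more parts have slack.\<close>
        have "t * (card P - 1) < card (crossing P G A)"
        proof -
          consider "card P \<le> 1" | "card P = 2" | "card P \<ge> 3" by linarith
          then show ?thesis
          proof cases
            case 1
            then show ?thesis using True fin by (auto simp: card_gt_0_iff)
          next
            case 2
            then show ?thesis using K(3)[OF P] True e(2) by force
          next
            case 3
            then show ?thesis using slack[OF P] by simp
          qed
        qed
        then show ?thesis using True fin unfolding cr by simp
      qed
      have largeB: "card (?B - crossing P G ?B) + t * (card P - 2) < card (c ` ?B)"
        if P: "partition_on (verts G) P" "3 \<le> card P" for P
      proof -
        have "card (?B - crossing P G ?B) \<le> card (A - crossing P G A)"
          using psubset.hyps by (intro card_mono) (auto simp: cr)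
        then show ?thesis using large[OF P] img by simp
      qed
      have "?B \<subset> A" "?B \<subseteq> edges G" using e(1) psubset.prems(1) by auto
      then obtain B where "B \<subseteq> ?B" "card B < card (c ` B) + t"
        "\<And>P. partition_on (verts G) P \<Longrightarrow> t * (card P - 1) \<le> card (crossing P G B)"
        using psubset.IH[OF _ _ psubset.prems(2) cutsB largeB] by blast
      then show ?thesis using psubset.prems(5)[of B] by blast
    qed
  qed
qed

text \<open>
  By pigeonhole some tree is rainbow; a symmetric exchange lets it meet a repeated color, so that
  removing it lowers the number of repetitions together with the number of trees.
\<close>

lemma rainbow_repacking:
  fixes c :: "'e \<Rightarrow> 'c" and T :: "'i \<Rightarrow> 'e set"
  assumes "finite I" "disjoint_family_on T I"
    and "\<And>i. i \<in> I \<Longrightarrow> indep G (T i) \<and> Suc (card (T i)) = card (verts G)"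
    and "card (\<Union>i\<in>I. T i) \<le> card (c ` (\<Union>i\<in>I. T i)) + (card I - 1)"
  shows "\<exists>T'. disjoint_family_on T' I \<and> (\<forall>i\<in>I. indep G (T' i) \<and> Suc (card (T' i)) = card (verts G)
    \<and> inj_on c (T' i) \<and> T' i \<subseteq> (\<Union>i\<in>I. T i))"
  using assms
proof (induction I arbitrary: T rule: finite_psubset_induct)
  case (psubset I)
  note disj = psubset.prems(1) and tree = psubset.prems(2)
  define U where "U = (\<Union>i\<in>I. T i)"
  have finT: "finite (T i)" if "i \<in> I" for i
    using tree[OF that] finite_subset_edges unfolding indep_def by blast
  then have finU: "finite U" unfolding U_def using psubset.hyps by blast
  show ?case
  proof (cases "inj_on c U")
    case True
    then have "\<forall>i\<in>I. indep G (T i) \<and> Suc (card (T i)) = card (verts G) \<and> inj_on c (T i) \<and> T i \<subseteq> (\<Union>i\<in>I. T i)"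
      using tree unfolding U_def by (auto intro: inj_on_subset)
    then show ?thesis using disj by blast
  next
    case False
    then obtain a a' where a: "a \<in> U" "a' \<in> U" "a \<noteq> a'" "c a = c a'" unfolding inj_on_def by blast
    have Ipos: "card I > 0" using a(1) psubset.hyps unfolding U_def by (auto simp: card_gt_0_iff)
    \<comment> \<open>If every tree repeated a color, there would be at least \<open>card I\<close>
      more edges than colors, one above the permitted surplus.\<close>
    have "\<exists>k\<in>I. inj_on c (T k)"
    proof (rule ccontr)
      assume n: "\<not> (\<exists>k\<in>I. inj_on c (T k))"
      have "card (c ` T i) + 1 \<le> card (T i)" if i: "i \<in> I" for i
        using n i finT[OF i] card_image_le[of "T i" c] eq_card_imp_inj_on[of "T i" c] by fastforce
      then have "(\<Sum>i\<in>I. card (c ` T i) + 1) \<le> (\<Sum>i\<in>I. card (T i))" by (rule sum_mono)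
      then have "(\<Sum>i\<in>I. card (c ` T i)) + card I \<le> (\<Sum>i\<in>I. card (T i))"
        by (simp only: sum.distrib) simp
      moreover have "card U = (\<Sum>i\<in>I. card (T i))"
        unfolding U_def using disj finT psubset.hyps by (intro card_UN_disjoint') auto
      moreover have "card (c ` U) \<le> (\<Sum>i\<in>I. card (c ` T i))"
        unfolding U_def image_UN using psubset.hyps by (rule card_UN_le)
      ultimately show False using psubset.prems(3) Ipos unfolding U_def by linarith
    qed
    then obtain k where k: "k \<in> I" "inj_on c (T k)" by blast
    \<comment> \<open>\<open>S\<close> rearranges the same edges so that \<open>S k\<close> is
      rainbow and contains an edge whose color recurs in \<open>U\<close>.\<close>
    obtain S where S: "disjoint_family_on S I" "(\<Union>i\<in>I. S i) = U" "inj_on c (S k)"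
      "\<And>i. i \<in> I \<Longrightarrow> indep G (S i) \<and> Suc (card (S i)) = card (verts G)"
      "\<exists>b\<in>S k. \<exists>b'\<in>U. b \<noteq> b' \<and> c b = c b'"
    proof (cases "\<exists>b\<in>T k. \<exists>b'\<in>U. b \<noteq> b' \<and> c b = c b'")
      case True
      then show thesis using that[of T] disj tree k unfolding U_def by blast
    next
      case n: False
      \<comment> \<open>No color of \<open>T k\<close> recurs in \<open>U\<close>, so
        \<open>a\<close> lies in another tree, and exchanging it into \<open>T k\<close> cannot
        create two equal colors there.\<close>
      then have aT: "a \<notin> T k" using a by blast
      obtain j where j: "j \<in> I" "a \<in> T j" using a(1) unfolding U_def by blast
      have jk: "j \<noteq> k" using j aT by blast
      obtain b where b: "b \<in> T k" "b \<notin> T j"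
        "indep G (insert a (T k - {b}))" "Suc (card (insert a (T k - {b}))) = card (verts G)"
        "indep G (insert b (T j - {a}))" "Suc (card (insert b (T j - {a}))) = card (verts G)"
        using tree_symmetric_exchange[of "T j" "T k" a] tree[OF j(1)] tree[OF k(1)] j(2) aT by blast
      define S where "S = T(k := insert a (T k - {b}), j := insert b (T j - {a}))"
      have Sk: "S k = insert a (T k - {b})" and Sj: "S j = insert b (T j - {a})"
        and So: "\<And>i. i \<noteq> k \<Longrightarrow> i \<noteq> j \<Longrightarrow> S i = T i"
        using jk unfolding S_def by auto
      have kj: "S k \<inter> S j = {}"
        using disjoint_family_onD[OF disj k(1) j(1)] jk aT b(1,2) unfolding Sk Sj by blast
      have oth: "S k \<inter> S i = {}" "S j \<inter> S i = {}" if "i \<in> I" "i \<noteq> k" "i \<noteq> j" for i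
        using disjoint_family_onD[OF disj k(1) that(1)] disjoint_family_onD[OF disj j(1) that(1)]
          that(2,3) j(2) b(1)
        unfolding Sk Sj So[OF that(2,3)] by blast+
      have "disjoint_family_on S I"
        unfolding disjoint_family_on_def
      proof (intro ballI impI)
        fix i i' assume ii: "i \<in> I" "i' \<in> I" "i \<noteq> i'"
        consider "i \<in> {k, j}" "i' \<in> {k, j}" | "i \<in> {k, j}" "i' \<notin> {k, j}"
          | "i \<notin> {k, j}" "i' \<in> {k, j}" | "i \<notin> {k, j}" "i' \<notin> {k, j}" by blast
        then show "S i \<inter> S i' = {}"
        proof cases
          case 1
          then show ?thesis using kj ii(3) by blast
        next
          case 2
          then show ?thesis using oth[of i'] ii by blast
        next
          case 3
          then show ?thesis using oth[of i] ii by blast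
        next
          case 4
          then show ?thesis using So[of i] So[of i'] disjoint_family_onD[OF disj ii] by simp
        qed
      qed
      moreover have "(\<Union>i\<in>I. S i) = U"
      proof -
        have rest: "(\<Union>i\<in>I. F i) = F k \<union> F j \<union> (\<Union>i\<in>I - {k, j}. F i)" for F :: "'i \<Rightarrow> 'e set"
          using k(1) j(1) by blast
        have "S k \<union> S j = T k \<union> T j" using b(1) j(2) unfolding Sk Sj by blast
        moreover have "(\<Union>i\<in>I - {k, j}. S i) = (\<Union>i\<in>I - {k, j}. T i)" using So by simp
        ultimately show ?thesis unfolding U_def rest[of S] rest[of T] by simp
      qed
      moreover have "inj_on c (S k)"
      proof -
        have "c x \<noteq> c a" if "x \<in> T k - {b}" for x
        proof -
          have "x \<in> T k" "x \<noteq> a" using that aT by auto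
          then show ?thesis using n a(1) by metis
        qed
        then have "c a \<notin> c ` (T k - {b})" by (metis imageE)
        moreover have "inj_on c (T k - {b})" using k(2) by (rule inj_on_subset) blast
        ultimately show ?thesis unfolding Sk using aT by simp
      qed
      moreover have "indep G (S i) \<and> Suc (card (S i)) = card (verts G)" if "i \<in> I" for i
        using tree[OF that] b unfolding S_def by auto
      moreover have "\<exists>b\<in>S k. \<exists>b'\<in>U. b \<noteq> b' \<and> c b = c b'" using a unfolding Sk by blast
      ultimately show thesis using that[of S] by blast
    qed
    obtain b b' where b: "b \<in> S k" "b' \<in> U" "b \<noteq> b'" "c b = c b'" using S(5) by blast
    define J where "J = I - {k}"
    define W where "W = (\<Union>i\<in>J. S i)"
    have "(\<Union>i\<in>I. S i) = S k \<union> W" unfolding W_def J_def using k(1) by blast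
    then have UW: "U = S k \<union> W" using S(2) by simp
    have dW: "S k \<inter> W = {}" using disjoint_family_onD[OF S(1) k(1)] unfolding W_def J_def by blast
    have finW: "finite W" "finite (S k)" using finU UW by auto
    \<comment> \<open>As \<open>S k\<close> is rainbow, the partner of \<open>b\<close> lies in
      another tree. The color of \<open>b\<close> survives in \<open>W\<close>, so removing
      \<open>S k\<close> loses at most \<open>card (S k) - 1\<close> colors.\<close>
    have "b' \<in> W" using b S(3) UW unfolding inj_on_def by blast
    then have "c ` U \<subseteq> c ` W \<union> c ` (S k - {b})" using UW b(4) by auto
    then have "card (c ` U) \<le> card (c ` W \<union> c ` (S k - {b}))" using finW by (intro card_mono) auto
    also have "\<dots> \<le> card (c ` W) + card (c ` (S k - {b}))" by (rule card_Un_le)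
    also have "\<dots> \<le> card (c ` W) + card (S k - {b})" using finW by (simp add: card_image_le)
    finally have "card (c ` U) + 1 \<le> card (c ` W) + card (S k)"
      using b(1) finW card_Suc_Diff1[of "S k" b] by linarith
    moreover have "card U = card (S k) + card W" unfolding UW using dW finW by (intro card_Un_disjoint)
    moreover have "card I = Suc (card J)" using k(1) psubset.hyps unfolding J_def by (metis card_Suc_Diff1)
    \<comment> \<open>With the preceding counts this forces \<open>card J\<close> to be positive, so
      \<open>card J - 1\<close> in the new bound is not truncated.\<close>
    moreover have "card (c ` W) \<le> card W" using finW by (intro card_image_le)
    ultimately have le: "card W \<le> card (c ` W) + (card J - 1)"
      using psubset.prems(3) unfolding U_def[symmetric] by linarith
    have "J \<subset> I" using k(1) unfolding J_def by blast
    moreover have "disjoint_family_on S J"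
      using S(1) disjoint_family_on_mono[of J I S] unfolding J_def by blast
    moreover have "\<And>i. i \<in> J \<Longrightarrow> indep G (S i) \<and> Suc (card (S i)) = card (verts G)"
      using S(4) unfolding J_def by blast
    ultimately obtain T' where T': "disjoint_family_on T' J"
      "\<forall>i\<in>J. indep G (T' i) \<and> Suc (card (T' i)) = card (verts G) \<and> inj_on c (T' i) \<and> T' i \<subseteq> W"
      using psubset.IH[of J S] le unfolding W_def by blast
    have Tk: "T' i \<inter> S k = {}" if "i \<in> J" for i using T'(2) that dW by blast
    have "disjoint_family_on (T'(k := S k)) I"
      unfolding disjoint_family_on_def
    proof (intro ballI impI)
      fix i i' assume ii: "i \<in> I" "i' \<in> I" "i \<noteq> i'"
      show "(T'(k := S k)) i \<inter> (T'(k := S k)) i' = {}"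
      proof (cases "i = k \<or> i' = k")
        case True
        then show ?thesis using ii Tk[of i] Tk[of i'] unfolding J_def by auto
      next
        case False
        then show ?thesis using ii disjoint_family_onD[OF T'(1), of i i'] unfolding J_def by auto
      qed
    qed
    moreover have "\<forall>i\<in>I. indep G ((T'(k := S k)) i) \<and> Suc (card ((T'(k := S k)) i)) = card (verts G)
        \<and> inj_on c ((T'(k := S k)) i) \<and> (T'(k := S k)) i \<subseteq> U"
    proof
      fix i assume "i \<in> I"
      then show "indep G ((T'(k := S k)) i) \<and> Suc (card ((T'(k := S k)) i)) = card (verts G)
        \<and> inj_on c ((T'(k := S k)) i) \<and> (T'(k := S k)) i \<subseteq> U"
        using T'(2) S(3) S(4)[OF k(1)] UW unfolding J_def by (cases "i = k") auto
    qed
    ultimately show ?thesis unfolding U_def by blast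
  qed
qed

theorem disjoint_rainbow_spanning_trees:
  fixes c :: "'e \<Rightarrow> 'c"
  assumes "t > 0"
    and "\<And>P. partition_on (verts G) P \<Longrightarrow> t * (card P - 1) \<le> card (crossing P G (edges G))"
    and "\<And>P. partition_on (verts G) P \<Longrightarrow> 3 \<le> card P \<Longrightarrow>
           card (edges G - crossing P G (edges G)) + t * (card P - 2) < card (c ` edges G)"
  shows "has_disjoint_rainbow_spanning_trees G c t"
proof -
  obtain B where B: "B \<subseteq> edges G" "card B < card (c ` B) + t"
    "\<And>P. partition_on (verts G) P \<Longrightarrow> t * (card P - 1) \<le> card (crossing P G B)"
    using reduce_repeated_colors[OF subset_refl assms] by blast
  obtain T where T: "forest_family G B t T" "\<And>i. i < t \<Longrightarrow> Suc (card (T i)) = card (verts G)"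
    using tree_packing[OF B(1,3)] by blast
  define U where "U = (\<Union>i<t. T i)"
  have UB: "U \<subseteq> B" using T(1) unfolding U_def forest_family_def by auto
  have finB: "finite B" using B(1) by (rule finite_subset_edges)
  have finU: "finite U" using UB finB by (rule finite_subset)
  \<comment> \<open>Each edge of \<open>B\<close> outside the trees accounts for at most one color,
    so the surplus of edges over colors does not grow from \<open>B\<close> to
    \<open>U\<close>.\<close>
  have "c ` B = c ` U \<union> c ` (B - U)" using UB by blast
  then have "card (c ` B) \<le> card (c ` U) + card (c ` (B - U))" by (metis card_Un_le)
  also have "\<dots> \<le> card (c ` U) + card (B - U)" using finB by (simp add: card_image_le)
  finally have "card (c ` B) \<le> card (c ` U) + card (B - U)" .
  moreover have "card B = card U + card (B - U)"
    using UB finB finU by (metis card_Diff_subset card_mono le_add_diff_inverse)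
  ultimately have "card U \<le> card (c ` U) + (card {..<t} - 1)" using B(2) by simp
  moreover have "disjoint_family_on T {..<t}" using T(1) unfolding forest_family_def by simp
  moreover have "\<And>i. i \<in> {..<t} \<Longrightarrow> indep G (T i) \<and> Suc (card (T i)) = card (verts G)"
    using T unfolding forest_family_def by simp
  ultimately obtain T' where T': "disjoint_family_on T' {..<t}"
    "\<forall>i\<in>{..<t}. indep G (T' i) \<and> Suc (card (T' i)) = card (verts G) \<and> inj_on c (T' i)"
    using rainbow_repacking[of "{..<t}" T c] unfolding U_def by blast
  then have "\<forall>i<t. spanning_tree G (T' i) \<and> rainbow c (T' i)"
    using indep_spanning_tree unfolding rainbow_def by blast
  then show ?thesis using T'(1) unfolding has_disjoint_rainbow_spanning_trees_def by blast
qed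

section \<open>Colorings without disjoint rainbow spanning trees\<close>

lemma noncrossing_eq: "noncrossing P G = edges G - crossing P G (edges G)"
  unfolding noncrossing_def crossing_def by auto

lemma card_crossing_eq: "card (crossing P G (edges G)) = card (edges G) - card (noncrossing P G)"
proof -
  have "crossing P G (edges G) = edges G - noncrossing P G" "noncrossing P G \<subseteq> edges G"
    unfolding noncrossing_def crossing_def by auto
  then show ?thesis by (simp add: card_Diff_subset finite_subset_edges)
qed

text \<open>Each spanning tree has at least \<open>card P - 1\<close> crossing edges, and disjoint
  trees share none. The count holds for every coloring, in particular for an injective one.\<close>

lemma no_packing_of_small_cut:
  assumes P: "partition_on (verts G) P"
    and less: "card (crossing P G (edges G)) < t * (card P - 1)"
  shows "\<not> has_disjoint_rainbow_spanning_trees G c t"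
proof
  assume "has_disjoint_rainbow_spanning_trees G c t"
  then obtain T :: "nat \<Rightarrow> 'e set" where T: "\<And>i. i < t \<Longrightarrow> spanning_tree G (T i)"
    "disjoint_family_on T {..<t}"
    unfolding has_disjoint_rainbow_spanning_trees_def by blast
  have TE: "T i \<subseteq> edges G" if "i < t" for i using T(1)[OF that] unfolding spanning_tree_def by simp
  have "t * (card P - 1) = (\<Sum>i<t. card P - 1)" by simp
  also have "\<dots> \<le> (\<Sum>i<t. card (crossing P G (T i)))"
    using T(1) P card_crossing_spanning_connected unfolding spanning_tree_def by (intro sum_mono) auto
  also have "\<dots> = card (\<Union>i<t. crossing P G (T i))"
  proof (rule card_UN_disjoint'[symmetric])
    show "disjoint_family_on (\<lambda>i. crossing P G (T i)) {..<t}"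
      using T(2) unfolding disjoint_family_on_def crossing_def by blast
    show "finite (crossing P G (T i))" if "i \<in> {..<t}" for i
      using that TE finite_subset_edges crossing_subset[of P G "T i"] by (meson lessThan_iff finite_subset)
  qed simp
  also have "\<dots> \<le> card (crossing P G (edges G))"
    using TE finite_edges by (intro card_mono) (auto simp: crossing_def)
  finally show False using less by simp
qed

text \<open>A rainbow tree uses the shared color 0 at most once, so at least
  \<open>card P - 2\<close> of its crossing edges lie in \<open>S\<close>. Then \<open>t\<close>
  disjoint ones need one edge more than \<open>S\<close> has.\<close>

lemma coloring_without_packing:
  assumes P: "partition_on (verts G) P" "card P \<ge> 3" and "t > 0"
    and cut: "t * (card P - 1) \<le> card (crossing P G (edges G))"
  obtains c :: "'e \<Rightarrow> nat" where "card (c ` edges G) = card (noncrossing P G) + t * (card P - 2)"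
    "\<not> has_disjoint_rainbow_spanning_trees G c t"
proof -
  let ?C = "crossing P G (edges G)"
  have finC: "finite ?C" using finite_edges crossing_subset by (rule finite_subset[rotated])
  have pos: "t * (card P - 2) > 0" using P(2) \<open>t > 0\<close> by simp
  have "t * (card P - 2) \<le> t * (card P - 1)" by (intro mult_le_mono2) simp
  then have less: "t * (card P - 2) - 1 < card ?C" using cut pos by linarith
  \<comment> \<open>The color missing from the count because of the \<open>- 1\<close> is supplied
    by color 0, which occurs because the cut condition leaves a crossing edge outside
    \<open>S\<close>.\<close>
  then obtain S where S: "S \<subseteq> ?C" "card S = t * (card P - 2) - 1"
    by (meson less_imp_le obtain_subset_with_card_n)
  have "S \<noteq> ?C" using S(2) less by auto
  then obtain e\<^sub>0 where e0: "e\<^sub>0 \<in> ?C" "e\<^sub>0 \<notin> S" using S(1) by blast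
  obtain f :: "'e \<Rightarrow> nat" where f: "inj_on f (edges G)"
    using finite_edges finite_imp_inj_to_nat_seg by blast
  let ?D = "noncrossing P G \<union> S"
  define c where "c = (\<lambda>e. if e \<in> ?D then Suc (f e) else 0)"
  have DE: "?D \<subseteq> edges G" using S(1) unfolding noncrossing_def crossing_def by blast
  have e0D: "e\<^sub>0 \<notin> ?D" using e0 unfolding noncrossing_def crossing_def by blast
  have e0E: "e\<^sub>0 \<in> edges G" using e0 unfolding crossing_def by blast
  have c0: "c e = 0" if "e \<notin> ?D" for e using that unfolding c_def by simp
  have cS: "c e = Suc (f e)" if "e \<in> ?D" for e using that unfolding c_def by simp
  have "c ` edges G = insert 0 (c ` ?D)"
    using DE e0D e0E c0 by (auto intro: image_eqI[of _ _ e\<^sub>0])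
  moreover have "0 \<notin> c ` ?D" using cS by force
  moreover have finD: "finite ?D" using DE by (rule finite_subset_edges)
  moreover have "card (c ` ?D) = card ?D"
  proof (rule card_image)
    show "inj_on c ?D" using f DE cS by (auto simp: inj_on_def subset_iff)
  qed
  moreover have "card ?D = card (noncrossing P G) + card S"
  proof (rule card_Un_disjoint)
    show "noncrossing P G \<inter> S = {}" using S(1) unfolding noncrossing_def crossing_def by blast
  qed (use finD in auto)
  ultimately have count: "card (c ` edges G) = card (noncrossing P G) + t * (card P - 2)"
    using S(2) pos by simp
  moreover have "\<not> has_disjoint_rainbow_spanning_trees G c t"
  proof
    assume "has_disjoint_rainbow_spanning_trees G c t"
    then obtain T :: "nat \<Rightarrow> 'e set" where T: "\<And>i. i < t \<Longrightarrow> spanning_tree G (T i) \<and> rainbow c (T i)"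
      "disjoint_family_on T {..<t}"
      unfolding has_disjoint_rainbow_spanning_trees_def by blast
    have finS: "finite S" using S(1) finC by (rule finite_subset)
    have "card P - 2 \<le> card (T i \<inter> S)" if i: "i < t" for i
    proof -
      have TE: "T i \<subseteq> edges G" and sc: "spanning_connected G (T i)" and inj: "inj_on c (T i)"
        using T(1)[OF i] unfolding spanning_tree_def rainbow_def by auto
      have sub: "crossing P G (T i) - S \<subseteq> {e \<in> T i. c e = 0}"
        using TE c0 unfolding crossing_def noncrossing_def by auto
      have "card {e \<in> T i. c e = 0} \<le> 1"
        using inj by (intro card_le_Suc0_iff_eq[THEN iffD2, unfolded One_nat_def[symmetric]])
          (use TE finite_subset_edges in \<open>auto simp: inj_on_def\<close>)
      moreover have "card (crossing P G (T i) - S) \<le> card {e \<in> T i. c e = 0}"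
        using sub TE finite_subset_edges by (intro card_mono) auto
      moreover have "card (crossing P G (T i)) \<le> card ((crossing P G (T i) - S) \<union> (T i \<inter> S))"
        using TE finS finite_subset_edges[OF TE] finite_subset[OF crossing_subset[of P G "T i"]]
        by (intro card_mono) (auto simp: crossing_def)
      moreover have "\<dots> \<le> card (crossing P G (T i) - S) + card (T i \<inter> S)" by (rule card_Un_le)
      moreover have "card P - 1 \<le> card (crossing P G (T i))"
        using card_crossing_spanning_connected[OF P(1) TE sc] .
      ultimately show ?thesis by linarith
    qed
    then have "(\<Sum>i<t. card P - 2) \<le> (\<Sum>i<t. card (T i \<inter> S))" by (intro sum_mono) simp
    also have "\<dots> = card (\<Union>i<t. T i \<inter> S)"
    proof (rule card_UN_disjoint'[symmetric])
      show "disjoint_family_on (\<lambda>i. T i \<inter> S) {..<t}"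
        using T(2) unfolding disjoint_family_on_def by blast
    qed (use finS in auto)
    also have "\<dots> \<le> card S" using finS by (intro card_mono) auto
    finally have "t * (card P - 2) \<le> card S" by simp
    then show False using S(2) pos by linarith
  qed
  ultimately show thesis using that by blast
qed

end

section \<open>The anti-Ramsey number\<close>

theorem theorem2:
  fixes G :: "('v, 'e) multigraph" and t :: nat
  assumes "finite_multigraph G" and "t > 0"
  shows "((\<exists>P\<^sub>0. partition_on (verts G) P\<^sub>0 \<and>
              card (edges G) - card (noncrossing P\<^sub>0 G) < t * (card P\<^sub>0 - 1))
           \<longrightarrow> anti_ramsey G t = card (edges G)) \<and>
         (\<not> (\<exists>P\<^sub>0. partition_on (verts G) P\<^sub>0 \<and>
              card (edges G) - card (noncrossing P\<^sub>0 G) < t * (card P\<^sub>0 - 1))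
           \<longrightarrow> anti_ramsey G t =
                 Max {card (noncrossing P G) + t * (card P - 2) | P.
                        partition_on (verts G) P \<and> card P \<ge> 3})"
proof -
  interpret fin_multigraph G using assms(1) by unfold_locales
  let ?C = "{card (c ` edges G) | c :: 'e \<Rightarrow> nat. \<not> has_disjoint_rainbow_spanning_trees G c t}"
  let ?M = "{card (noncrossing P G) + t * (card P - 2) | P. partition_on (verts G) P \<and> card P \<ge> 3}"
  have cr: "card (edges G) - card (noncrossing P G) = card (crossing P G (edges G))" for P
    by (simp add: card_crossing_eq)
  have bound: "n \<le> card (edges G)" if "n \<in> ?C" for n
    using that finite_edges by (auto simp: card_image_le)
  then have finC: "finite ?C" by (meson finite_nat_set_iff_bounded_le)
  show ?thesis
  proof (intro conjI impI)
    assume "\<exists>P\<^sub>0. partition_on (verts G) P\<^sub>0 \<and>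
              card (edges G) - card (noncrossing P\<^sub>0 G) < t * (card P\<^sub>0 - 1)"
    then obtain P where P: "partition_on (verts G) P"
      "card (crossing P G (edges G)) < t * (card P - 1)"
      unfolding cr by blast
    obtain f :: "'e \<Rightarrow> nat" where f: "inj_on f (edges G)"
      using finite_edges finite_imp_inj_to_nat_seg by blast
    \<comment> \<open>The injective coloring attains the upper bound
      \<open>card (edges G)\<close>.\<close>
    have "card (edges G) \<in> ?C"
      using no_packing_of_small_cut[OF P, of f] card_image[OF f] by force
    then show "anti_ramsey G t = card (edges G)"
      unfolding anti_ramsey_def using bound finC by (intro Max_eqI)
  next
    assume "\<not> (\<exists>P\<^sub>0. partition_on (verts G) P\<^sub>0 \<and>
              card (edges G) - card (noncrossing P\<^sub>0 G) < t * (card P\<^sub>0 - 1))"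
    then have cuts: "t * (card P - 1) \<le> card (crossing P G (edges G))"
      if "partition_on (verts G) P" for P
      using that unfolding cr by (meson not_le)
    have MC: "?M \<subseteq> ?C"
    proof
      fix n assume "n \<in> ?M"
      then obtain P where P: "partition_on (verts G) P" "card P \<ge> 3"
        and n: "n = card (noncrossing P G) + t * (card P - 2)" by blast
      obtain c :: "'e \<Rightarrow> nat" where "card (c ` edges G) = n" "\<not> has_disjoint_rainbow_spanning_trees G c t"
        using coloring_without_packing[OF P assms(2) cuts[OF P(1)]] n by metis
      then show "n \<in> ?C" by blast
    qed
    have CM: "\<exists>m\<in>?M. n \<le> m" if nC: "n \<in> ?C" for n
    proof -
      obtain c :: "'e \<Rightarrow> nat" where n: "n = card (c ` edges G)"
        and c: "\<not> has_disjoint_rainbow_spanning_trees G c t" using nC by blast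
      have "\<exists>P. partition_on (verts G) P \<and> 3 \<le> card P \<and>
          \<not> card (edges G - crossing P G (edges G)) + t * (card P - 2) < card (c ` edges G)"
        using disjoint_rainbow_spanning_trees[OF assms(2) cuts, of c] c by blast
      then obtain P where P: "partition_on (verts G) P" "3 \<le> card P"
        "n \<le> card (noncrossing P G) + t * (card P - 2)"
        unfolding noncrossing_eq n by (metis not_le)
      then show ?thesis by blast
    qed
    \<comment> \<open>\<open>?M\<close> lies inside \<open>?C\<close>, and every element of
      \<open>?C\<close> is at most some element of \<open>?M\<close>; this suffices for equal maxima
      when \<open>?C\<close> is nonempty.\<close>
    show "anti_ramsey G t = Max ?M"
    proof (cases "?C = {}")
      case True
      \<comment> \<open>At most two vertices: both sides are the unspecified maximum of the empty set.\<close>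
      then have "?M = {}" using MC by blast
      then show ?thesis unfolding anti_ramsey_def using True by (simp only:)
    next
      case False
      have finM: "finite ?M" using MC finC by (rule finite_subset)
      have "?M \<noteq> {}" using False CM by blast
      show ?thesis unfolding anti_ramsey_def
      proof (rule Max_eqI[OF finC])
        fix n assume "n \<in> ?C"
        then obtain m where "m \<in> ?M" "n \<le> m" using CM by blast
        then show "n \<le> Max ?M" using Max_ge[OF finM, of m] by linarith
      next
        show "Max ?M \<in> ?C" using Max_in[OF finM \<open>?M \<noteq> {}\<close>] MC by blast
      qed
    qed
  qed
qed

end
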